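(* Let $p(x)\in\mathbb{Z}[x]$. The following are equivalent characterizations for the array $(s_{n,k,r}^{p(x)}(q))_{0\le r\le k\le n}$ (where for all other values of the triple $(n,k,r)$ we assume $s_{n,k,r}^{p(x)}(q)=0$): (1) (Defining equation/generating function) $$(x-[p(r)]_q)(x-[p(r+1)]_q)\cdots(x-[p(n-1)]_q)=\sum_{k=r}^n s_{n,k,r}^{p(x)}(q)\,x^{k-r}.$$ (2) (Recursion) For each $n\ge k>r$: $$s_{n,k,r}^{p(x)}(q)=s_{n-1,k-1,r}^{p(x)}(q)-[p(n-1)]_q\,s_{n-1,k,r}^{p(x)}(q),$$ with the boundary conditions $s_{n,r,r}^{p(x)}(q)=(-1)^{n-r}[p(r)]_q[p(r+1)]_q\cdots[p(n-1)]_q$ and $s_{r,k,r}^{p(x)}(q)=\delta_{kr}$. (3) (Complete recursion) For $n\ge k>r$: $$s_{n,k,r}^{p(x)}(q)=\sum_{j=k}^n(-1)^{n-j}s_{j-1,k-1,r}^{p(x)}(q)\prod_{i=j}^{n-1}[p(i)]_q,$$ subject to the same boundary conditions as in condition (2). (4) (Explicit formula) For $n\ge k\ge r$: $$s_{n,k,r}^{p(x)}(q)=(-1)^{n-k}\left[\prod_{j=r}^{n-1}[p(j)]_q\right]\sum_{r\le i_{r+1}<\cdots<i_k\le n-1}\frac{1}{[p(i_{r+1})]_q\cdots[p(i_k)]_q}.$$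
   Context: Here $[m]_q=1+q+\cdots+q^{m-1}=\frac{q^m-1}{q-1}$ is the $q$-analogue of $m$, $\delta$ is the Kronecker delta, and empty products equal $1$. For $p(x)\in\mathbb{Z}[x]$, the type II (signed) $q,r$-poly-Stirling numbers of the first kind $s_{n,k,r}^{p(x)}(q)$ are defined by the recurrence $s_{n,k,r}^{p(x)}(q)=s_{n-1,k-1,r}^{p(x)}(q)-[p(n-1)]_q s_{n-1,k,r}^{p(x)}(q)$ for $r\le k\le n$, $n>r$, with $s_{r,r,r}^{p(x)}(q)=1$ and $s_{n,k,r}^{p(x)}(q)=0$ for $k<r$, $k>n$ or $n<r$.
   Formalization: Formula (4) is undefined when some [p(j)]_q = 0 (e.g. p = x, r = 0, n = k = 1); it is proved for all p with denominators cancelled against the product in front, and in its literal form when no bracket [p(j)]_q vanishes. *)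

theory Defs
  imports "HOL-Computational_Algebra.Polynomial"
begin

text \<open>
  The parameter \<open>q\<close> is an arbitrary element of an arbitrary field. The case of an indeterminate
  \<open>q\<close> is the instance where the field is a field of rational functions in \<open>q\<close>. Since a polynomial
  with integer coefficients can take negative values at natural numbers, the q-analogue is
  needed for all integers. For negative arguments the sum below is
  \<open>(q\<^sup>m - 1) / (q - 1) = - (q\<^sup>-\<^sup>1 + \<dots> + q\<^sup>m)\<close>; it is meaningful only for \<open>q \<noteq> 0\<close>.
\<close>

definition q_analogue :: "'a::field \<Rightarrow> int \<Rightarrow> 'a" where
  "q_analogue q m =
     (if 0 \<le> m then (\<Sum>i<nat m. q ^ i) else - (\<Sum>i=1..nat (- m). inverse q ^ i))"

lemma q_analogue_eq_quotient:
  assumes "q \<noteq> 0" and "q \<noteq> 1"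
  shows "q_analogue q m = (q powi m - 1) / (q - 1)"
proof (cases "0 \<le> m")
  case True
  then show ?thesis
    using assms by (simp add: q_analogue_def geometric_sum power_int_def)
next
  case False
  have *: "(\<Sum>i=1..N. inverse q ^ i) * (q - 1) = 1 - inverse q ^ N" for N
    using assms by (induction N) (auto simp: field_simps)
  show ?thesis
    using False assms *[of "nat (- m)"]
    by (simp add: q_analogue_def power_int_def field_simps)
qed

definition bracket :: "int poly \<Rightarrow> 'a::field \<Rightarrow> nat \<Rightarrow> 'a" where
  "bracket p q j = q_analogue q (poly p (int j))"

text \<open>
  Arguments in the order \<open>n\<close>, \<open>k\<close>, \<open>r\<close>. In the recurrence the entry with column index
  \<open>k - 1\<close> is \<open>0\<close> when \<open>k = 0\<close>, because then \<open>k - 1 = - 1 < r\<close>.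
\<close>

fun qr_poly_stirling1 :: "int poly \<Rightarrow> 'a::field \<Rightarrow> nat \<Rightarrow> nat \<Rightarrow> nat \<Rightarrow> 'a" where
  "qr_poly_stirling1 p q 0 k r = (if k = 0 \<and> r = 0 then 1 else 0)"
| "qr_poly_stirling1 p q (Suc n) k r =
     (if k < r \<or> Suc n < k \<or> Suc n < r then 0
      else if Suc n = r then 1
      else (case k of 0 \<Rightarrow> 0 | Suc k' \<Rightarrow> qr_poly_stirling1 p q n k' r)
             - bracket p q n * qr_poly_stirling1 p q n k r)"

lemma qr_poly_stirling1_outside:
  "k < r \<or> n < k \<or> n < r \<Longrightarrow> qr_poly_stirling1 p q n k r = 0"
  by (cases n) auto

lemma qr_poly_stirling1_diag: "qr_poly_stirling1 p q r r r = 1"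
  by (cases r) auto

lemma qr_poly_stirling1_rec:
  assumes "r \<le> k" "k \<le> n" "r < n" "0 < k"
  shows "qr_poly_stirling1 p q n k r =
           qr_poly_stirling1 p q (n - 1) (k - 1) r
             - bracket p q (n - 1) * qr_poly_stirling1 p q (n - 1) k r"
  using assms by (cases n; cases k) auto

lemma qr_poly_stirling1_rec_0:
  assumes "0 < n"
  shows "qr_poly_stirling1 p q n 0 0 =
           - bracket p q (n - 1) * qr_poly_stirling1 p q (n - 1) 0 0"
  using assms by (cases n) auto

definition defining_equation ::
    "int poly \<Rightarrow> 'a::field \<Rightarrow> (nat \<Rightarrow> nat \<Rightarrow> nat \<Rightarrow> 'a) \<Rightarrow> bool" where
  "defining_equation p q s \<longleftrightarrow>
     (\<forall>n r. r \<le> n \<longrightarrow>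
        (\<Prod>j=r..<n. [:0, 1:] - [:bracket p q j:]) = (\<Sum>k=r..n. monom (s n k r) (k - r)))"

definition boundary_conditions ::
    "int poly \<Rightarrow> 'a::field \<Rightarrow> (nat \<Rightarrow> nat \<Rightarrow> nat \<Rightarrow> 'a) \<Rightarrow> bool" where
  "boundary_conditions p q s \<longleftrightarrow>
     (\<forall>n r. r \<le> n \<longrightarrow> s n r r = (- 1) ^ (n - r) * (\<Prod>j=r..<n. bracket p q j)) \<and>
     (\<forall>k r. s r k r = (if k = r then 1 else 0))"

definition recursion ::
    "int poly \<Rightarrow> 'a::field \<Rightarrow> (nat \<Rightarrow> nat \<Rightarrow> nat \<Rightarrow> 'a) \<Rightarrow> bool" where
  "recursion p q s \<longleftrightarrow>
     (\<forall>n k r. r < k \<and> k \<le> n \<longrightarrow>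
        s n k r = s (n - 1) (k - 1) r - bracket p q (n - 1) * s (n - 1) k r) \<and>
     boundary_conditions p q s"

definition complete_recursion ::
    "int poly \<Rightarrow> 'a::field \<Rightarrow> (nat \<Rightarrow> nat \<Rightarrow> nat \<Rightarrow> 'a) \<Rightarrow> bool" where
  "complete_recursion p q s \<longleftrightarrow>
     (\<forall>n k r. r < k \<and> k \<le> n \<longrightarrow>
        s n k r =
          (\<Sum>j=k..n. (- 1) ^ (n - j) * s (j - 1) (k - 1) r * (\<Prod>i=j..<n. bracket p q i))) \<and>
     boundary_conditions p q s"

text \<open>
  A chain \<open>r \<le> i\<^bsub>r+1\<^esub> < \<dots> < i\<^bsub>k\<^esub> \<le> n - 1\<close> is encoded as the set of its \<open>k - r\<close> members.
\<close>

definition index_sets :: "nat \<Rightarrow> nat \<Rightarrow> nat \<Rightarrow> nat set set" where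
  "index_sets n k r = {I. I \<subseteq> {r..<n} \<and> card I = k - r}"

definition explicit_formula ::
    "int poly \<Rightarrow> 'a::field \<Rightarrow> (nat \<Rightarrow> nat \<Rightarrow> nat \<Rightarrow> 'a) \<Rightarrow> bool" where
  "explicit_formula p q s \<longleftrightarrow>
     (\<forall>n k r. r \<le> k \<and> k \<le> n \<longrightarrow>
        s n k r =
          (- 1) ^ (n - k) * (\<Prod>j=r..<n. bracket p q j) *
            (\<Sum>I\<in>index_sets n k r. 1 / (\<Prod>i\<in>I. bracket p q i)))"

text \<open>
  The explicit formula divides by brackets, so it is literally meaningful only if these are
  nonzero, which fails already for \<open>p = x\<close> and \<open>r = 0\<close>. When some bracket vanishes, every
  denominator is to be cancelled against the product in front of the sum (as if the brackets
  were indeterminates) before evaluating. With nonzero brackets this changes nothing, see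
  \<open>cancelled_explicit_formula_iff\<close>.
\<close>

definition cancelled_explicit_formula ::
    "int poly \<Rightarrow> 'a::field \<Rightarrow> (nat \<Rightarrow> nat \<Rightarrow> nat \<Rightarrow> 'a) \<Rightarrow> bool" where
  "cancelled_explicit_formula p q s \<longleftrightarrow>
     (\<forall>n k r. r \<le> k \<and> k \<le> n \<longrightarrow>
        s n k r =
          (- 1) ^ (n - k) * (\<Sum>I\<in>index_sets n k r. \<Prod>j\<in>{r..<n} - I. bracket p q j))"

lemma explicit_summand_cancel:
  assumes "\<And>j. r \<le> j \<Longrightarrow> j < n \<Longrightarrow> bracket p q j \<noteq> 0"
  shows "(\<Prod>j=r..<n. bracket p q j) * (\<Sum>I\<in>index_sets n k r. 1 / (\<Prod>i\<in>I. bracket p q i)) =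
         (\<Sum>I\<in>index_sets n k r. \<Prod>j\<in>{r..<n} - I. bracket p q j)"
  unfolding sum_distrib_left
proof (rule sum.cong[OF refl])
  fix I assume "I \<in> index_sets n k r"
  then have I: "I \<subseteq> {r..<n}" by (simp add: index_sets_def)
  then have fin: "finite I" using finite_subset by blast
  have "(\<Prod>i\<in>I. bracket p q i) \<noteq> 0"
    using I assms fin by (auto simp: subset_iff)
  moreover have "(\<Prod>j=r..<n. bracket p q j) =
      (\<Prod>j\<in>{r..<n} - I. bracket p q j) * (\<Prod>i\<in>I. bracket p q i)"
    using I by (simp add: prod.subset_diff)
  ultimately show "(\<Prod>j=r..<n. bracket p q j) * (1 / (\<Prod>i\<in>I. bracket p q i)) =
      (\<Prod>j\<in>{r..<n} - I. bracket p q j)" by simp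
qed

lemma cancelled_explicit_formula_iff:
  assumes "\<And>j. bracket p q j \<noteq> 0"
  shows "cancelled_explicit_formula p q s \<longleftrightarrow> explicit_formula p q s"
  unfolding cancelled_explicit_formula_def explicit_formula_def
  by (simp add: explicit_summand_cancel assms mult.assoc)

end

theory Submission
  imports Defs
begin

text \<open>
  Write \<open>S n k r\<close> for the numbers defined by the recurrence and \<open>P n r\<close> for the product of the
  factors \<open>x - b j\<close> with \<open>r \<le> j < n\<close>, where \<open>b j\<close> is the bracket of \<open>p j\<close>. Everything rests on the
  fact that \<open>S n k r\<close> is the coefficient of \<open>x\<^bsup>k - r\<^esup>\<close> in \<open>P n r\<close>
  (\<open>coeff_linear_product_eq_stirling\<close>): multiplying \<open>P n r\<close> by the next factor \<open>x - b n\<close> shifts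
  coefficients and subtracts \<open>b n\<close> times the old ones, which is the recurrence.

  The defining equation fixes the coefficients of \<open>P n r\<close>, so it says of an array \<open>s\<close> exactly that
  it agrees with \<open>S\<close> in the triangle \<open>r \<le> k \<le> n\<close>. Choosing \<open>x\<close> or \<open>- b j\<close> from each factor
  computes the same coefficients as signed elementary symmetric functions of the \<open>b j\<close>
  (\<open>coeff_prod_monic_linear\<close>, one of the formulas of Vieta). This is the cancelled form of the explicit
  formula, in which the set \<open>I\<close> collects the factors that contribute \<open>x\<close>; for nonzero brackets it
  is the form with denominators.

  The recursion and its boundary values determine the triangle by induction on \<open>n\<close>. The complete recursion is the
  recursion iterated downwards in \<open>n\<close> until \<open>n = k - 1\<close>, where the entry in column \<open>k\<close> vanishes;
  conversely, the sums for \<open>n\<close> and \<open>n + 1\<close> differ by a factor \<open>- b n\<close> and a single new term, so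
  the recursion can be read off again (\<open>complete_recursion_iff_recursion\<close>).
\<close>

section \<open>Coefficients of a product of monic linear factors\<close>

text \<open>
  Expand the product by choosing from each factor either \<open>x\<close>, for the indices in \<open>I\<close>, or the
  constant \<open>- b j\<close>; the choice contributes to degree \<open>card I\<close> only.
\<close>

lemma coeff_prod_monic_linear:
  fixes b :: "'b \<Rightarrow> 'a::comm_ring_1"
  assumes "finite A"
  shows "coeff (\<Prod>j\<in>A. [:0, 1:] - [:b j:]) m =
           (- 1) ^ (card A - m) * (\<Sum>I | I \<subseteq> A \<and> card I = m. \<Prod>j\<in>A - I. b j)"
proof -
  have const: "(\<Prod>j\<in>X. [:b j:]) = [:\<Prod>j\<in>X. b j:]" for X
    by (induction X rule: infinite_finite_induct) (auto simp: one_pCons)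
  have sign: "(- 1) ^ e = [:(- 1) ^ e :: 'a:]" for e
    by (induction e) (simp_all add: one_pCons)
  have "(\<Prod>j\<in>A. [:0, 1:] - [:b j:]) =
      (\<Sum>I\<in>Pow A. (- 1) ^ (card A - card I) * (\<Prod>j\<in>I. [:0, 1:]) * (\<Prod>j\<in>A - I. [:b j:]))"
    by (rule prod_diff_conv_sum'[OF assms])
  also have "\<dots> = (\<Sum>I\<in>Pow A. monom ((- 1) ^ (card A - card I) * (\<Prod>j\<in>A - I. b j)) (card I))"
    by (simp add: const sign monom_altdef mult.commute)
  finally have "coeff (\<Prod>j\<in>A. [:0, 1:] - [:b j:]) m =
      (\<Sum>I\<in>Pow A. if card I = m then (- 1) ^ (card A - m) * (\<Prod>j\<in>A - I. b j) else 0)"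
    by (auto simp: coeff_sum intro!: sum.cong)
  also have "\<dots> = (\<Sum>I | I \<subseteq> A \<and> card I = m. (- 1) ^ (card A - m) * (\<Prod>j\<in>A - I. b j))"
    using assms by (simp add: sum.If_cases Int_def)
  finally show ?thesis
    by (simp add: sum_distrib_left)
qed

lemma coeff_linear_product_eq_stirling:
  assumes "r \<le> n"
  shows "coeff (\<Prod>j=r..<n. [:0, 1:] - [:bracket p q j:]) m = qr_poly_stirling1 p q n (m + r) r"
  using assms
proof (induction n arbitrary: m rule: dec_induct)
  case base
  then show ?case
    by (cases "m = 0") (auto simp: qr_poly_stirling1_diag qr_poly_stirling1_outside)
next
  case (step n)
  define P where "P = (\<Prod>j=r..<n. [:0, 1:] - [:bracket p q j:])"
  have "(\<Prod>j=r..<Suc n. [:0, 1:] - [:bracket p q j:]) = P * ([:0, 1:] - [:bracket p q n:])"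
    unfolding P_def using step.hyps by (intro prod.atLeastLessThan_Suc) auto
  also have "\<dots> = pCons 0 P - smult (bracket p q n) P"
    by (simp add: mult.commute[of P])
  finally have "coeff (\<Prod>j=r..<Suc n. [:0, 1:] - [:bracket p q j:]) m =
      (case m of 0 \<Rightarrow> 0 | Suc l \<Rightarrow> coeff P l) - bracket p q n * coeff P m"
    by (simp only: coeff_diff coeff_pCons coeff_smult)
  moreover have "coeff P l = qr_poly_stirling1 p q n (l + r) r" for l
    unfolding P_def by (rule step.IH)
  ultimately show ?case
    using step.hyps by (cases m; cases r) (auto simp: qr_poly_stirling1_outside)
qed

section \<open>Arrays supported in the triangle\<close>

lemma eq_stirling_iff_triangle:
  assumes "\<And>n k r. \<not> (r \<le> k \<and> k \<le> n) \<Longrightarrow> s n k r = 0"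
  shows "s = qr_poly_stirling1 p q \<longleftrightarrow>
           (\<forall>n k r. r \<le> k \<and> k \<le> n \<longrightarrow> s n k r = qr_poly_stirling1 p q n k r)"
proof (intro iffI ext)
  fix n k r
  assume "\<forall>n k r. r \<le> k \<and> k \<le> n \<longrightarrow> s n k r = qr_poly_stirling1 p q n k r"
  then show "s n k r = qr_poly_stirling1 p q n k r"
    by (cases "r \<le> k \<and> k \<le> n") (auto simp: assms qr_poly_stirling1_outside)
qed simp

lemma defining_equation_iff_triangle:
  "defining_equation p q s \<longleftrightarrow>
     (\<forall>n k r. r \<le> k \<and> k \<le> n \<longrightarrow> s n k r = qr_poly_stirling1 p q n k r)"
proof -
  have coeff_rhs: "coeff (\<Sum>k=r..n. monom (s n k r) (k - r)) m =
      (if m + r \<le> n then s n (m + r) r else 0)" for n r m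
  proof -
    have "coeff (\<Sum>k=r..n. monom (s n k r) (k - r)) m =
        (\<Sum>k=r..n. if k = m + r then s n k r else 0)"
      unfolding coeff_sum coeff_monom by (rule sum.cong) auto
    then show ?thesis by simp
  qed
  have "(\<Prod>j=r..<n. [:0, 1:] - [:bracket p q j:]) = (\<Sum>k=r..n. monom (s n k r) (k - r)) \<longleftrightarrow>
      (\<forall>k. r \<le> k \<and> k \<le> n \<longrightarrow> s n k r = qr_poly_stirling1 p q n k r)"
    if "r \<le> n" for n r
  proof -
    have "(\<Prod>j=r..<n. [:0, 1:] - [:bracket p q j:]) = (\<Sum>k=r..n. monom (s n k r) (k - r)) \<longleftrightarrow>
        (\<forall>m. qr_poly_stirling1 p q n (m + r) r = (if m + r \<le> n then s n (m + r) r else 0))"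
      by (simp only: poly_eq_iff coeff_rhs coeff_linear_product_eq_stirling[OF that])
    also have "\<dots> \<longleftrightarrow> (\<forall>m. m + r \<le> n \<longrightarrow> s n (m + r) r = qr_poly_stirling1 p q n (m + r) r)"
      by (auto simp: qr_poly_stirling1_outside)
    also have "\<dots> \<longleftrightarrow> (\<forall>k. r \<le> k \<and> k \<le> n \<longrightarrow> s n k r = qr_poly_stirling1 p q n k r)"
      by (metis le_add2 le_add_diff_inverse2)
    finally show ?thesis .
  qed
  then show ?thesis
    unfolding defining_equation_def by (meson order_trans)
qed

lemma cancelled_explicit_formula_iff_triangle:
  "cancelled_explicit_formula p q s \<longleftrightarrow>
     (\<forall>n k r. r \<le> k \<and> k \<le> n \<longrightarrow> s n k r = qr_poly_stirling1 p q n k r)"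
proof -
  have "(- 1) ^ (n - k) * (\<Sum>I\<in>index_sets n k r. \<Prod>j\<in>{r..<n} - I. bracket p q j) =
      qr_poly_stirling1 p q n k r" if "r \<le> k" "k \<le> n" for n k r
    using that coeff_linear_product_eq_stirling[of r n p q "k - r"]
      coeff_prod_monic_linear[of "{r..<n}" "bracket p q" "k - r"]
    by (simp add: index_sets_def)
  then show ?thesis
    unfolding cancelled_explicit_formula_def by simp
qed

section \<open>The two recursions\<close>

lemma stirling_column_r:
  assumes "r \<le> n"
  shows "qr_poly_stirling1 p q n r r = (- 1) ^ (n - r) * (\<Prod>j=r..<n. bracket p q j)"
  using assms
proof (induction n rule: dec_induct)
  case base
  then show ?case by (simp add: qr_poly_stirling1_diag)
next
  case (step n)
  have "qr_poly_stirling1 p q (Suc n) r r = - bracket p q n * qr_poly_stirling1 p q n r r"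
    using step.hyps by (cases r) (auto simp: qr_poly_stirling1_outside)
  then show ?case
    using step by (simp add: Suc_diff_le mult_ac)
qed

lemma stirling_boundary: "boundary_conditions p q (qr_poly_stirling1 p q)"
  unfolding boundary_conditions_def
proof (intro conjI allI impI)
  show "qr_poly_stirling1 p q r k r = (if k = r then 1 else 0)" for k r
    by (cases k r rule: linorder_cases)
      (auto simp: qr_poly_stirling1_diag qr_poly_stirling1_outside)
qed (rule stirling_column_r)

lemma stirling_recursion: "recursion p q (qr_poly_stirling1 p q)"
  unfolding recursion_def
  by (intro conjI allI impI stirling_boundary qr_poly_stirling1_rec) auto

lemma recursion_unique:
  assumes "recursion p q s" "recursion p q t"
    and "\<And>n k r. \<not> (r \<le> k \<and> k \<le> n) \<Longrightarrow> s n k r = 0"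
    and "\<And>n k r. \<not> (r \<le> k \<and> k \<le> n) \<Longrightarrow> t n k r = 0"
  shows "s = t"
proof (intro ext)
  fix n k r
  show "s n k r = t n k r"
  proof (induction n arbitrary: k)
    case 0
    show ?case
      using assms by (cases "r = 0 \<and> k = 0") (auto simp: recursion_def boundary_conditions_def)
  next
    case (Suc n)
    consider "\<not> (r \<le> k \<and> k \<le> Suc n)" | "k = r" "r \<le> Suc n" | "r < k" "k \<le> Suc n"
      by linarith
    then show ?case
    proof cases
      case 1
      then show ?thesis using assms(3,4) by metis
    next
      case 2
      then show ?thesis using assms(1,2) by (simp add: recursion_def boundary_conditions_def)
    next
      case 3
      then show ?thesis using assms(1,2) Suc.IH by (simp add: recursion_def)
    qed
  qed
qed

text \<open>
  Passing from \<open>n\<close> to \<open>n + 1\<close> multiplies each old summand by \<open>- b n\<close> and adds the summand for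
  \<open>j = n + 1\<close>. Hence the right-hand side of the complete recursion satisfies the recursion with
  the array \<open>s\<close> itself in column \<open>k - 1\<close>.
\<close>

lemma complete_sum_Suc:
  fixes s :: "nat \<Rightarrow> 'a::comm_ring_1"
  assumes "k \<le> Suc n"
  shows "(\<Sum>j=k..Suc n. (- 1) ^ (Suc n - j) * s (j - 1) * (\<Prod>i=j..<Suc n. b i)) =
         s n - b n * (\<Sum>j=k..n. (- 1) ^ (n - j) * s (j - 1) * (\<Prod>i=j..<n. b i))"
proof -
  have "(\<Sum>j=k..n. (- 1) ^ (Suc n - j) * s (j - 1) * (\<Prod>i=j..<Suc n. b i)) =
      (\<Sum>j=k..n. - b n * ((- 1) ^ (n - j) * s (j - 1) * (\<Prod>i=j..<n. b i)))"
    by (rule sum.cong) (auto simp: Suc_diff_le algebra_simps)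
  then show ?thesis
    using assms by (simp add: sum_negf flip: sum_distrib_left)
qed

text \<open>
  The support hypothesis starts the iteration: in row \<open>n = k - 1\<close> the entry in column \<open>k\<close> and the
  empty sum are both zero.
\<close>

lemma complete_recursion_iff_recursion:
  assumes supp: "\<And>n k r. \<not> (r \<le> k \<and> k \<le> n) \<Longrightarrow> s n k r = 0"
  shows "complete_recursion p q s \<longleftrightarrow> recursion p q s"
proof -
  define C where "C n k r =
    (\<Sum>j=k..n. (- 1) ^ (n - j) * s (j - 1) (k - 1) r * (\<Prod>i=j..<n. bracket p q i))" for n k r
  have C_Suc: "C (Suc n) k r = s n (k - 1) r - bracket p q n * C n k r" if "k \<le> Suc n" for n k r
    unfolding C_def using complete_sum_Suc[OF that, of "\<lambda>i. s i (k - 1) r"] .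
  have C_0: "C n k r = 0" if "n < k" for n k r
    using that by (simp add: C_def)
  have "(\<forall>n k. r < k \<and> k \<le> n \<longrightarrow> s n k r = C n k r) \<longleftrightarrow>
      (\<forall>n k. r < k \<and> k \<le> n \<longrightarrow>
        s n k r = s (n - 1) (k - 1) r - bracket p q (n - 1) * s (n - 1) k r)"
    (is "?complete \<longleftrightarrow> ?rec") for r
  proof
    assume complete: ?complete
    show ?rec
    proof (intro allI impI)
      fix n k assume k: "r < k \<and> k \<le> n"
      then obtain m where m: "n = Suc m" by (cases n) auto
      have "s m k r = C m k r"
        using complete k C_0 supp by (cases "k \<le> m") auto
      then show "s n k r = s (n - 1) (k - 1) r - bracket p q (n - 1) * s (n - 1) k r"
        using complete k C_Suc m by simp
    qed
  next
    assume rec: ?rec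
    have "s n k r = C n k r" if "r < k" for n k
    proof (induction n)
      case 0
      then show ?case using that C_0 supp by simp
    next
      case (Suc n)
      show ?case
      proof (cases "k \<le> Suc n")
        case True
        then show ?thesis using rec that Suc.IH C_Suc by simp
      qed (use C_0 supp in auto)
    qed
    then show ?complete by simp
  qed
  then show ?thesis
    unfolding complete_recursion_def recursion_def C_def by blast
qed

section \<open>Equivalence of the characterizations\<close>

theorem theorem6p2:
  fixes p :: "int poly" and q :: "'a::field" and s :: "nat \<Rightarrow> nat \<Rightarrow> nat \<Rightarrow> 'a"
  assumes "\<And>n k r. \<not> (r \<le> k \<and> k \<le> n) \<Longrightarrow> s n k r = 0"
  shows "(s = qr_poly_stirling1 p q \<longleftrightarrow> defining_equation p q s) \<and>
         (s = qr_poly_stirling1 p q \<longleftrightarrow> recursion p q s) \<and>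
         (s = qr_poly_stirling1 p q \<longleftrightarrow> complete_recursion p q s) \<and>
         (s = qr_poly_stirling1 p q \<longleftrightarrow> cancelled_explicit_formula p q s) \<and>
         ((\<forall>j. bracket p q j \<noteq> 0) \<longrightarrow>
            (s = qr_poly_stirling1 p q \<longleftrightarrow> explicit_formula p q s))"
proof -
  note triangle = eq_stirling_iff_triangle[of s p q, OF assms]
  have explicit: "s = qr_poly_stirling1 p q \<longleftrightarrow> cancelled_explicit_formula p q s"
    using triangle cancelled_explicit_formula_iff_triangle by blast
  have rec: "s = qr_poly_stirling1 p q \<longleftrightarrow> recursion p q s"
    using stirling_recursion recursion_unique[of p q s "qr_poly_stirling1 p q", OF _ _ assms]
      qr_poly_stirling1_outside by (metis not_le)
  show ?thesis
  proof (intro conjI impI)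
    show "s = qr_poly_stirling1 p q \<longleftrightarrow> defining_equation p q s"
      using triangle defining_equation_iff_triangle by blast
    show "s = qr_poly_stirling1 p q \<longleftrightarrow> complete_recursion p q s"
      using rec complete_recursion_iff_recursion[of s p q, OF assms] by blast
    show "s = qr_poly_stirling1 p q \<longleftrightarrow> explicit_formula p q s" if "\<forall>j. bracket p q j \<noteq> 0"
      using explicit cancelled_explicit_formula_iff that by blast
  qed (fact rec explicit)+
qed

end
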